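(* Let $C\in\mathcal K^2$ be Minkowski centered such that $$\left(\frac{C^\circ - C^\circ}{2}\right)^{\circ}\subset^{opt} \frac{C-C}{2}.$$ Then $s(C)\leq \varphi$. Moreover, if $s(C)=\varphi$, there exists a non-singular linear transformation $L$ of $\mathbb R^2$ such that $L(C)=\mathbb{GH}$, where $\mathbb{GH}:= \mathrm{conv}(\{p^1, \dots, p^5 \})$ with $p^1= (-1,-1)^T$, $p^2=(-1,0)^T$, $p^3=\left(0, \varphi \right)^T$, $p^4= (1,0)^T$, $p^5=(1,-1)^T$.
   Context: $\varphi=(1+\sqrt5)/2$ is the golden ratio. $\mathcal K^n$ denotes the set of convex bodies in $\mathbb R^n$, i.e. full-dimensional compact convex sets. $\mathrm{conv}(X)$ is the convex hull of $X$. For $K,C\subset\mathbb R^n$ and $\rho\in\mathbb R$: $K+C=\{a+b:a\in K,b\in C\}$, $\rho C=\{\rho x:x\in C\}$, $-C=(-1)C$, and $K-C=K+(-C)$ (so $C^\circ-C^\circ=C^\circ+(-C^\circ)$); $\frac{1}{2}(\cdot)$ is dilatation by $1/2$. For $K\in\mathcal K^n$, $K^\circ=\{a\in\mathbb R^n: a^Tx\le 1 \text{ for all } x\in K\}$ is the polar of $K$. Optimal containment: for $K,C\in\mathcal K^n$, $K\subset^{opt}C$ means that $K\subset C$ and $K\not\subset t+\rho C$ for any $0\le\rho<1$ and $t\in\mathbb R^n$. Minkowski asymmetry: $s(C):=\inf\{\rho>0: C-c\subset\rho(c-C) \text{ for some } c\in\mathbb R^n\}$. A Minkowski center of $C$ is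 any $c\in\mathbb R^n$ with $C-c\subset s(C)(c-C)$. $C$ is Minkowski centered if $0$ is a Minkowski center of $C$, i.e. $C\subset -s(C)\,C$. *)

theory Defs
  imports "HOL-Analysis.Analysis" "HOL-Library.Set_Algebras"
begin

definition golden_ratio :: real where
  "golden_ratio = (1 + sqrt 5) / 2"

definition convex_body :: "'a::euclidean_space set \<Rightarrow> bool" where
  "convex_body K \<longleftrightarrow> compact K \<and> convex K \<and> aff_dim K = int DIM('a)"

text \<open>On sets, \<open>A - B\<close> and \<open>- A\<close> denote set difference and complement in HOL, so the
  reflection of \<open>C\<close> is written \<open>dilate (-1) C\<close>, and the Minkowski difference gets its own name.
  The sum is the elementwise one of \<open>Set_Algebras\<close>.\<close>

definition dilate :: "real \<Rightarrow> 'a::real_vector set \<Rightarrow> 'a set" where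
  "dilate \<rho> C = (\<lambda>x. \<rho> *\<^sub>R x) ` C"

definition mink_diff :: "'a::real_vector set \<Rightarrow> 'a set \<Rightarrow> 'a set" where
  "mink_diff K C = K + dilate (-1) C"

definition polar :: "'a::real_inner set \<Rightarrow> 'a set" where
  "polar K = {a. \<forall>x\<in>K. a \<bullet> x \<le> 1}"

definition opt_contained :: "'a::real_vector set \<Rightarrow> 'a set \<Rightarrow> bool" where
  "opt_contained K C \<longleftrightarrow>
     K \<subseteq> C \<and> (\<forall>\<rho> t. 0 \<le> \<rho> \<and> \<rho> < 1 \<longrightarrow> \<not> K \<subseteq> {t} + dilate \<rho> C)"

definition mink_asymmetry :: "'a::real_vector set \<Rightarrow> real" where
  "mink_asymmetry C =
     Inf {\<rho>. \<rho> > 0 \<and> (\<exists>c. mink_diff C {c} \<subseteq> dilate \<rho> (mink_diff {c} C))}"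

definition mink_center :: "'a::real_vector set \<Rightarrow> 'a \<Rightarrow> bool" where
  "mink_center C c \<longleftrightarrow> mink_diff C {c} \<subseteq> dilate (mink_asymmetry C) (mink_diff {c} C)"

definition mink_centered :: "'a::real_vector set \<Rightarrow> bool" where
  "mink_centered C \<longleftrightarrow> mink_center C 0"

definition golden_house :: "(real ^ 2) set" where
  "golden_house = convex hull
     {vector [-1, -1], vector [-1, 0], vector [0, golden_ratio], vector [1, 0], vector [1, -1]}"

lemma mink_centered_iff:
  "mink_centered C \<longleftrightarrow> C \<subseteq> dilate (- mink_asymmetry C) C"
proof -
  have "mink_diff C {0} = C"
    by (auto simp: mink_diff_def dilate_def set_plus_def)
  moreover have "mink_diff {0} C = dilate (-1) C"
    by (auto simp: mink_diff_def dilate_def set_plus_def)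
  ultimately show ?thesis
    by (simp add: mink_centered_def mink_center_def dilate_def image_image)
qed

end

theory Submission
  imports Defs
begin

text \<open>
  Write \<open>s\<close> for the asymmetry of \<open>C\<close>. A point \<open>p\<close> at which the harmonic mean touches the arithmetic
  mean, with common outer normal \<open>a\<close>, satisfies \<open>1 / h(a) + 1 / h(- a) \<le> 2\<close> and
  \<open>h(a) + h(- a) \<le> 2\<close>, where \<open>h\<close> is the support function of \<open>C\<close>. Hence both values are \<open>1\<close>, \<open>\<plusminus>p\<close>
  lie in \<open>C\<close>, and \<open>C\<close> lies in the strip \<open>\<bar>a \<bullet> x\<bar> \<le> 1\<close>.

  By minimality of \<open>s\<close> there are at most three points of \<open>C\<close> on the boundary of \<open>- s C\<close> whose
  normals balance to \<open>0\<close>. Choose coordinates with \<open>p = (1, 0)\<close> and strip \<open>\<bar>x\<bar> \<le> 1\<close>. None of the normals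
  \<open>(\<alpha>, \<beta>)\<close> is horizontal, so up to reflection one points up and two point down. Pairing the upper
  contact with each lower one, and eliminating the second coordinates, gives
  \<open>1 - r\<^sup>2 \<le> \<alpha>1 (x1 + r x2) + \<alpha>2 (x2 + r x1)\<close> with \<open>r = 1 / s\<close>, where \<open>\<bar>\<alpha>\<bar> \<le> r\<close> and \<open>\<bar>x\<bar> \<le> 1\<close>.
  Together these force \<open>r\<^sup>2 + r \<ge> 1\<close>, that is \<open>s \<le> \<phi>\<close>, and equality determines all contacts.
\<close>

section \<open>Separation and polars\<close>

text \<open>A scaled bipolar argument, the tool for placing points in dilates. Since
  \<open>0\<close> lies in the dilate, the separating level \<open>b\<close> is negative, so
  \<open>a\<close> rescaled by \<open>\<rho> / b\<close> is a polar vector exceeding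
  \<open>\<rho>\<close> at \<open>x\<close>.\<close>

lemma mem_dilate_if_polar_le:
  fixes A :: "'a::euclidean_space set"
  assumes "closed A" "convex A" "0 \<in> A" "\<rho> > 0"
    and le: "\<And>a. a \<in> polar A \<Longrightarrow> a \<bullet> x \<le> \<rho>"
  shows "x \<in> dilate \<rho> A"
proof (rule ccontr)
  assume "x \<notin> dilate \<rho> A"
  moreover have "closed (dilate \<rho> A)" "convex (dilate \<rho> A)"
    unfolding dilate_def using assms by (auto intro: closed_scaling convex_scaling)
  ultimately obtain a b where ab: "a \<bullet> x < b" "\<And>y. y \<in> dilate \<rho> A \<Longrightarrow> b < a \<bullet> y"
    using separating_hyperplane_closed_point[of "dilate \<rho> A" x] by blast
  have "0 \<in> dilate \<rho> A"
    using \<open>0 \<in> A\<close> by (force simp: dilate_def)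
  with ab(2) have "b < 0"
    by fastforce
  have "(\<rho> / b) *\<^sub>R a \<in> polar A"
    unfolding polar_def
  proof (intro CollectI ballI)
    fix y assume "y \<in> A"
    then have "b < a \<bullet> (\<rho> *\<^sub>R y)"
      by (intro ab(2)) (unfold dilate_def, rule imageI)
    with \<open>b < 0\<close> show "(\<rho> / b) *\<^sub>R a \<bullet> y \<le> 1"
      by (simp add: divide_le_eq)
  qed
  from le[OF this] have "\<rho> * (a \<bullet> x / b) \<le> \<rho> * 1"
    by simp
  with \<open>\<rho> > 0\<close> have "a \<bullet> x / b \<le> 1"
    by (simp only: mult_le_cancel_left_pos)
  with ab(1) \<open>b < 0\<close> show False
    by (simp add: divide_le_eq)
qed

lemma compact_polar:
  fixes A :: "'a::euclidean_space set"
  assumes "0 \<in> interior A"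
  shows "compact (polar A)"
proof -
  obtain e where e: "e > 0" "cball 0 e \<subseteq> A"
    using assms by (auto simp: mem_interior_cball)
  have "norm a \<le> 1 / e" if "a \<in> polar A" for a
  proof (cases "a = 0")
    case False
    have "(e / norm a) *\<^sub>R a \<in> A"
      using e False by (auto intro!: subsetD[OF e(2)])
    with that have "a \<bullet> ((e / norm a) *\<^sub>R a) \<le> 1"
      by (auto simp: polar_def)
    with False have "e * norm a \<le> 1"
      by (simp add: dot_square_norm power2_eq_square)
    with e(1) show ?thesis
      by (simp add: field_simps)
  qed (use e in simp)
  then have "bounded (polar A)"
    by (auto simp: bounded_iff)
  moreover have "polar A = (\<Inter>x\<in>A. {a. a \<bullet> x \<le> 1})"
    by (auto simp: polar_def)
  then have "closed (polar A)"
    by (auto intro!: closed_INT closed_Collect_le continuous_intros)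
  ultimately show ?thesis
    by (simp add: compact_eq_bounded_closed)
qed

section \<open>Contacts with the smallest reflected copy\<close>

text \<open>If \<open>0\<close> could be separated from the contact normals by some \<open>v\<close>, then \<open>C - t v\<close> with small
  \<open>t > 0\<close> would fit into a smaller copy of \<open>- s C\<close>.\<close>

lemma zero_mem_hull_contact_normals:
  fixes C :: "'a::euclidean_space set"
  assumes "compact C" "convex C" "0 \<in> interior C" "mink_centered C"
    and pos: "mink_asymmetry C > 0"
  shows "0 \<in> convex hull {a \<in> polar (dilate (- mink_asymmetry C) C). \<exists>x\<in>C. a \<bullet> x = 1}"
    (is "0 \<in> convex hull ?N")
proof (rule ccontr)
  define s where "s = mink_asymmetry C"
  define E where "E = dilate (-s) C"
  assume no: "0 \<notin> convex hull ?N"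
  have CE: "C \<subseteq> E"
    using assms(4) by (simp add: mink_centered_iff E_def s_def)
  have E: "closed E" "convex E"
    unfolding E_def dilate_def
    by (intro closed_scaling convex_scaling compact_imp_closed assms)+
  have "0 \<in> interior E"
    using interior_mono[OF CE] assms by blast
  then have "compact (polar E)" "0 \<in> E"
    using compact_polar interior_subset by blast+
  have prod: "compact (polar E \<times> C)"
    by (intro compact_Times \<open>compact (polar E)\<close> \<open>compact C\<close>)
  \<comment> \<open>As a projection of a closed slice of a compact product, the set of normals is
    compact; so is its hull, and \<open>0\<close> can be separated from it strictly.\<close>
  have N: "?N = fst ` ((polar E \<times> C) \<inter> {z. fst z \<bullet> snd z = 1})"
    by (force simp: E_def s_def)
  have "compact ?N"
    unfolding N by (intro compact_continuous_image continuous_intros compact_Int_closed prod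
      closed_Collect_eq)
  then have "closed (convex hull ?N)"
    by (simp add: compact_convex_hull compact_imp_closed)
  with no obtain v b where "v \<bullet> 0 < b" and sep: "\<And>a. a \<in> convex hull ?N \<Longrightarrow> b < v \<bullet> a"
    using separating_hyperplane_closed_point[of "convex hull ?N" 0] by auto
  then have "b > 0"
    by simp
  \<comment> \<open>\<open>K\<close> collects the pairs whose normal is not beyond level
    \<open>b\<close>. There the product cannot be \<open>1\<close>, since \<open>a\<close> would
    then be a contact normal; compactness turns this into a uniform gap
    \<open>\<delta>\<close>.\<close>
  define K where "K = (polar E \<times> C) \<inter> {z. v \<bullet> fst z \<le> b}"
  have "compact K"
    unfolding K_def by (intro compact_Int_closed prod closed_Collect_le continuous_intros)
  have lt: "fst z \<bullet> snd z < 1" if "z \<in> K" for z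
  proof -
    from that CE have "fst z \<bullet> snd z \<le> 1"
      by (auto simp: K_def polar_def)
    moreover have "fst z \<bullet> snd z \<noteq> 1"
      using that sep[OF hull_inc, of "fst z"] by (force simp: K_def E_def s_def)
    ultimately show ?thesis
      by simp
  qed
  obtain \<delta> where \<delta>: "\<delta> > 0" "\<And>z. z \<in> K \<Longrightarrow> fst z \<bullet> snd z \<le> 1 - \<delta>"
  proof (cases "K = {}")
    case True
    then show ?thesis using that[of 1] by simp
  next
    case False
    have "continuous_on K (\<lambda>z. fst z \<bullet> snd z)"
      by (intro continuous_intros)
    from continuous_attains_sup[OF \<open>compact K\<close> False this]
    obtain z where "z \<in> K" "\<And>w. w \<in> K \<Longrightarrow> fst w \<bullet> snd w \<le> fst z \<bullet> snd z"
      by blast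
    then show ?thesis
      using that[of "1 - fst z \<bullet> snd z"] lt by simp
  qed
  obtain M where M: "M > 0" "\<And>a. a \<in> polar E \<Longrightarrow> norm a \<le> M"
    using compact_imp_bounded[OF \<open>compact (polar E)\<close>] by (auto simp: bounded_pos)
  \<comment> \<open>Shifting by \<open>t v\<close> costs at most \<open>\<delta> / 2\<close> on
    \<open>K\<close>. The summand \<open>1\<close> keeps the denominator positive even if
    \<open>v = 0\<close>.\<close>
  define t where "t = \<delta> / (2 * (norm v + 1) * M)"
  have "t > 0"
    unfolding t_def using \<delta>(1) M(1) by (intro divide_pos_pos mult_pos_pos) (auto intro: add_nonneg_pos)
  \<comment> \<open>The entry \<open>1 / 2\<close> ensures positivity, the second serves the pairs
    in \<open>K\<close>, and the third the normals beyond level \<open>b\<close>, which gain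
    \<open>t * b\<close> from the shift.\<close>
  define \<rho> where "\<rho> = Max {1 / 2, 1 - \<delta> / 2, 1 - t * b}"
  have \<rho>: "\<rho> > 0" "\<rho> < 1" "1 - \<delta> / 2 \<le> \<rho>" "1 - t * b \<le> \<rho>"
    using \<delta>(1) \<open>t > 0\<close> \<open>b > 0\<close> by (auto simp: \<rho>_def less_max_iff_disj)
  have sub: "x - t *\<^sub>R v \<in> dilate \<rho> E" if "x \<in> C" for x
  proof (rule mem_dilate_if_polar_le)
    fix a assume a: "a \<in> polar E"
    show "a \<bullet> (x - t *\<^sub>R v) \<le> \<rho>"
    proof (cases "v \<bullet> a \<le> b")
      case True
      have "- (a \<bullet> v) \<le> norm a * norm v"
        using Cauchy_Schwarz_ineq2[of a v] by linarith
      also have "\<dots> \<le> M * (norm v + 1)"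
        using M a by (intro mult_mono) auto
      finally have "t * (- (a \<bullet> v)) \<le> t * (M * (norm v + 1))"
        using \<open>t > 0\<close> by (intro mult_left_mono) auto
      also have "\<dots> = \<delta> / 2"
        using M(1) norm_ge_zero[of v] unfolding t_def
        by (simp add: divide_simps add_nonneg_eq_0_iff)
      finally have "- (t * (a \<bullet> v)) \<le> \<delta> / 2"
        by simp
      moreover have "a \<bullet> x \<le> 1 - \<delta>"
        using \<delta>(2)[of "(a, x)"] a that True by (simp add: K_def)
      ultimately show ?thesis
        using \<rho>(3) by (simp add: inner_diff_right)
    next
      case False
      then have "t * b \<le> t * (a \<bullet> v)"
        using \<open>t > 0\<close> by (simp add: inner_commute)
      moreover have "a \<bullet> x \<le> 1"
        using a that CE by (auto simp: polar_def)
      ultimately show ?thesis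
        using \<rho>(4) by (simp add: inner_diff_right)
    qed
  qed (use E \<open>0 \<in> E\<close> \<rho> in auto)
  define \<sigma> where "\<sigma> = \<rho> * s"
  have "\<sigma> > 0"
    using \<rho>(1) pos by (simp add: \<sigma>_def s_def)
  \<comment> \<open>\<open>C - t v \<subseteq> - \<sigma> C\<close> is \<open>C - c \<subseteq> \<sigma> (c - C)\<close> for the \<open>c\<close> with \<open>(1 + \<sigma>) c = t v\<close>.\<close>
  define c where "c = (t / (1 + \<sigma>)) *\<^sub>R v"
  have c: "t *\<^sub>R v = c + \<sigma> *\<^sub>R c"
  proof -
    have "t *\<^sub>R v = (1 + \<sigma>) *\<^sub>R c"
      using \<open>\<sigma> > 0\<close> by (simp add: c_def)
    then show ?thesis
      by (simp add: scaleR_left_distrib)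
  qed
  have "mink_diff C {c} \<subseteq> dilate \<sigma> (mink_diff {c} C)"
  proof
    fix z assume "z \<in> mink_diff C {c}"
    then obtain x where x: "x \<in> C" "z = x - c"
      by (auto simp: mink_diff_def dilate_def set_plus_def)
    from sub[OF x(1)] obtain y where y: "y \<in> C" "x - t *\<^sub>R v = - \<sigma> *\<^sub>R y"
      by (auto simp: dilate_def E_def \<sigma>_def)
    then have "x = (c + \<sigma> *\<^sub>R c) - \<sigma> *\<^sub>R y"
      using c by (simp add: algebra_simps)
    then have "z = (c + \<sigma> *\<^sub>R c) - \<sigma> *\<^sub>R y - c"
      unfolding x(2) by (simp only:)
    then have "z = \<sigma> *\<^sub>R (c + (-1) *\<^sub>R y)"
      by (simp add: scaleR_right_diff_distrib)
    moreover have "c + (-1) *\<^sub>R y \<in> mink_diff {c} C"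
      unfolding mink_diff_def dilate_def using y(1) by (intro set_plus_intro) auto
    ultimately show "z \<in> dilate \<sigma> (mink_diff {c} C)"
      by (auto simp: dilate_def)
  qed
  then have "s \<le> \<sigma>"
    unfolding s_def mink_asymmetry_def using \<open>\<sigma> > 0\<close>
    by (intro cInf_lower) (auto intro!: bdd_belowI[of _ 0])
  moreover have "\<sigma> < s"
    using \<rho>(2) pos by (simp add: \<sigma>_def s_def)
  ultimately show False
    by simp
qed

text \<open>An interior point \<open>c\<close> equals \<open>- s y\<close> for some \<open>y\<close>
  in \<open>C\<close>. Hence \<open>0\<close> lies on the segment from \<open>y\<close> to
  \<open>c\<close> with positive weight \<open>1 / (1 + s)\<close> on \<open>c\<close>, and is
  interior by convexity.\<close>

lemma zero_mem_interior_if_subset_reflection: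
  fixes C :: "'a::euclidean_space set"
  assumes "convex_body C" "C \<subseteq> dilate (- s) C" "s > 0"
  shows "0 \<in> interior C"
proof -
  have C: "convex C" "interior C \<noteq> {}"
    using assms(1) interior_rel_interior_gen[of C] rel_interior_eq_empty[of C]
    by (auto simp: convex_body_def)
  then obtain c where c: "c \<in> interior C"
    by blast
  then obtain y where y: "y \<in> C" "c = - s *\<^sub>R y"
    using assms(2) interior_subset by (force simp: dilate_def)
  have "y - c = (1 + s) *\<^sub>R y"
    using y(2) by (simp add: algebra_simps)
  then have "y - (1 / (1 + s)) *\<^sub>R (y - c) = y - ((1 / (1 + s)) * (1 + s)) *\<^sub>R y"
    by simp
  also have "\<dots> = 0"
    using assms(3) by simp
  finally have "y - (1 / (1 + s)) *\<^sub>R (y - c) = 0" .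
  moreover have "y - (1 / (1 + s)) *\<^sub>R (y - c) \<in> interior C"
    using mem_interior_convex_shrink[OF C(1) c y(1), of "1 / (1 + s)"] assms(3) by simp
  ultimately show ?thesis
    by simp
qed

section \<open>Contact of the harmonic and arithmetic means\<close>

lemma opt_contained_harmonic_arithmetic_imp_contact:
  fixes C :: "'a::euclidean_space set"
  assumes "compact C" "convex C" "0 \<in> interior C"
    and opt: "opt_contained (polar (dilate (1/2) (mink_diff (polar C) (polar C))))
                (dilate (1/2) (mink_diff C C))"
  obtains p a where "p \<in> C" "- p \<in> C" "a \<bullet> p = 1" "\<And>x. x \<in> C \<Longrightarrow> \<bar>a \<bullet> x\<bar> \<le> 1"
proof -
  define H where "H = polar (dilate (1/2) (mink_diff (polar C) (polar C)))"
  define A where "A = dilate (1/2) (mink_diff C C)"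
  have diff: "mink_diff X Y = {x - y | x y. x \<in> X \<and> y \<in> Y}" for X Y :: "'a set"
    unfolding mink_diff_def dilate_def set_plus_def by force
  have H: "p \<in> H \<longleftrightarrow> (\<forall>b\<in>polar C. \<forall>b'\<in>polar C. (b - b') \<bullet> p \<le> 2)" for p
  proof -
    have "p \<in> H \<longleftrightarrow> (\<forall>z\<in>mink_diff (polar C) (polar C). p \<bullet> ((1/2) *\<^sub>R z) \<le> 1)"
      unfolding H_def polar_def[of "dilate _ _"] unfolding dilate_def by simp
    also have "\<dots> \<longleftrightarrow> (\<forall>b\<in>polar C. \<forall>b'\<in>polar C. p \<bullet> ((1/2) *\<^sub>R (b - b')) \<le> 1)"
      unfolding diff by blast
    finally show ?thesis
      by (simp add: inner_commute)
  qed
  have A: "closed A" "convex A"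
  proof -
    have "compact (mink_diff C C)"
      unfolding diff using compact_differences[OF assms(1) assms(1)] .
    moreover have "mink_diff C C = (\<Union>x\<in>C. \<Union>y\<in>C. {x - y})"
      unfolding diff by blast
    then have "convex (mink_diff C C)"
      using convex_differences[OF assms(2) assms(2)] by simp
    ultimately show "closed A" "convex A"
      unfolding A_def dilate_def by (auto intro: closed_scaling convex_scaling compact_imp_closed)
  qed
  have "closed C" "0 \<in> C"
    using assms interior_subset compact_imp_closed by blast+
  have half: "(1/2) *\<^sub>R (x - y) \<in> A" if "x \<in> C" "y \<in> C" for x y
    using that unfolding A_def dilate_def diff by blast
  obtain e where e: "e > 0" "cball 0 e \<subseteq> C"
    using assms(3) by (auto simp: mem_interior_cball)
  have "cball 0 e \<subseteq> A"
  proof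
    fix x :: 'a assume "x \<in> cball 0 e"
    then have "x \<in> C" "- x \<in> C"
      using e(2) by auto
    from half[OF this] show "x \<in> A"
      by (simp flip: scaleR_2)
  qed
  then have "0 \<in> interior A"
    using e(1) by (auto simp: mem_interior_cball)
  then have "compact (polar A)" "0 \<in> A"
    using compact_polar interior_subset by blast+
  have "{0} + dilate \<rho> A = dilate \<rho> A" for \<rho>
    by (auto simp: set_plus_def)
  then have "H \<subseteq> A" and opt': "\<And>\<rho>. 0 \<le> \<rho> \<Longrightarrow> \<rho> < 1 \<Longrightarrow> \<not> H \<subseteq> dilate \<rho> A"
    using opt unfolding opt_contained_def H_def[symmetric] A_def[symmetric] by metis+
  have "H = (\<Inter>b\<in>polar C. \<Inter>b'\<in>polar C. {p. (b - b') \<bullet> p \<le> 2})"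
    using H by auto
  then have "closed H"
    by (simp add: closed_INT closed_halfspace_le)
  moreover have "compact A"
    unfolding A_def dilate_def diff
    by (intro compact_scaling compact_differences assms)
  then have "bounded H"
    using \<open>H \<subseteq> A\<close> bounded_subset compact_imp_bounded by blast
  ultimately have "compact H"
    by (simp add: compact_eq_bounded_closed)
  have "0 \<in> H" "0 \<in> polar A"
    by (auto simp: H polar_def)
  then have ne: "polar A \<times> H \<noteq> {}"
    by blast
  have "compact (polar A \<times> H)"
    using \<open>compact H\<close> \<open>compact (polar A)\<close> by (rule compact_Times[rotated])
  moreover have "continuous_on (polar A \<times> H) (\<lambda>z. fst z \<bullet> snd z)"
    by (intro continuous_intros)
  ultimately obtain a p where ap: "a \<in> polar A" "p \<in> H"
    and sup: "\<And>b q. b \<in> polar A \<Longrightarrow> q \<in> H \<Longrightarrow> b \<bullet> q \<le> a \<bullet> p"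
    using continuous_attains_sup[OF _ ne] by (force simp: mem_Times_iff)
  \<comment> \<open>A maximum below \<open>1\<close> would put \<open>H\<close> into a smaller
    dilate of \<open>A\<close>, against optimality. The bound \<open>1/2\<close> only keeps the
    factor positive.\<close>
  have ge: "a \<bullet> p \<ge> 1"
  proof (rule ccontr)
    assume "\<not> a \<bullet> p \<ge> 1"
    then have \<rho>: "max (1/2) (a \<bullet> p) < 1" "max (1/2) (a \<bullet> p) > 0"
      by auto
    have "H \<subseteq> dilate (max (1/2) (a \<bullet> p)) A"
    proof
      fix q assume "q \<in> H"
      with sup show "q \<in> dilate (max (1/2) (a \<bullet> p)) A"
        by (intro mem_dilate_if_polar_le A \<open>0 \<in> A\<close> \<rho>) (simp add: le_max_iff_disj)
    qed
    with opt' \<rho> show False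
      by (meson less_imp_le)
  qed
  then have "a \<noteq> 0"
    by auto
  have "continuous_on C (\<lambda>x. a \<bullet> x)"
    by (intro continuous_intros)
  moreover have "C \<noteq> {}"
    using \<open>0 \<in> C\<close> by blast
  ultimately obtain u v where u: "u \<in> C" "\<And>x. x \<in> C \<Longrightarrow> a \<bullet> x \<le> a \<bullet> u"
    and v: "v \<in> C" "\<And>x. x \<in> C \<Longrightarrow> a \<bullet> v \<le> a \<bullet> x"
    using continuous_attains_sup[OF \<open>compact C\<close>, of "\<lambda>x. a \<bullet> x"]
      continuous_attains_inf[OF \<open>compact C\<close>, of "\<lambda>x. a \<bullet> x"]
    by blast
  define \<alpha> \<beta> where "\<alpha> = a \<bullet> u" and "\<beta> = - (a \<bullet> v)"
  have ball: "(e / norm a) *\<^sub>R a \<in> C" "- ((e / norm a) *\<^sub>R a) \<in> C"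
    using e \<open>a \<noteq> 0\<close> by (auto intro!: subsetD[OF e(2)])
  have pos: "(e / norm a) * (a \<bullet> a) > 0"
    using e \<open>a \<noteq> 0\<close> by simp
  have \<alpha>\<beta>: "\<alpha> > 0" "\<beta> > 0"
    using u(2)[OF ball(1)] v(2)[OF ball(2)] pos by (auto simp: \<alpha>_def \<beta>_def)
  have sum2: "\<alpha> + \<beta> \<le> 2"
    using ap(1) half[OF u(1) v(1)] by (auto simp: polar_def \<alpha>_def \<beta>_def inner_diff_right)
  have normals: "(1 / \<alpha>) *\<^sub>R a \<in> polar C" "- ((1 / \<beta>) *\<^sub>R a) \<in> polar C"
  proof -
    have "a \<bullet> x / \<alpha> \<le> 1" "- (a \<bullet> x) / \<beta> \<le> 1" if "x \<in> C" for x
      unfolding pos_divide_le_eq[OF \<alpha>\<beta>(1)] pos_divide_le_eq[OF \<alpha>\<beta>(2)]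
      using u(2)[OF that] v(2)[OF that] by (simp_all add: \<alpha>_def \<beta>_def)
    then show "(1 / \<alpha>) *\<^sub>R a \<in> polar C" "- ((1 / \<beta>) *\<^sub>R a) \<in> polar C"
      by (auto simp: polar_def)
  qed
  have "((1 / \<alpha>) *\<^sub>R a - - ((1 / \<beta>) *\<^sub>R a)) \<bullet> p \<le> 2"
    using ap(2) normals unfolding H by blast
  then have "(1 / \<alpha> + 1 / \<beta>) * (a \<bullet> p) \<le> 2"
    by (simp add: inner_add_left algebra_simps)
  moreover have "(1 / \<alpha> + 1 / \<beta>) * 1 \<le> (1 / \<alpha> + 1 / \<beta>) * (a \<bullet> p)"
    using ge \<alpha>\<beta> by (intro mult_left_mono) auto
  ultimately have "(1 / \<alpha> + 1 / \<beta>) * 1 \<le> 2"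
    by (rule order_trans[rotated])
  then have recips: "1 / \<alpha> + 1 / \<beta> \<le> 2"
    by simp
  \<comment> \<open>The line \<open>2 - t\<close> is the tangent to \<open>1 / t\<close> at
    \<open>1\<close>. As \<open>\<alpha> + \<beta>\<close> and the sum of the reciprocals are both
    at most \<open>2\<close>, tangency must hold for both values.\<close>
  have recip: "2 - t \<le> 1 / t" if "t > 0" for t :: real
    unfolding pos_le_divide_eq[OF that] using zero_le_power2[of "t - 1"]
    by (simp add: power2_eq_square algebra_simps)
  have "1 / \<alpha> = 2 - \<alpha>" and "1 / \<beta> = 2 - \<beta>"
    using recips recip[OF \<alpha>\<beta>(1)] recip[OF \<alpha>\<beta>(2)] sum2 by linarith+
  then have "\<alpha> * (2 - \<alpha>) = 1" "\<beta> * (2 - \<beta>) = 1"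
    using \<alpha>\<beta> by (simp_all flip: \<open>1 / \<alpha> = 2 - \<alpha>\<close> \<open>1 / \<beta> = 2 - \<beta>\<close>)
  then have "(\<alpha> - 1)\<^sup>2 = 0" and "(\<beta> - 1)\<^sup>2 = 0"
    by algebra+
  then have one: "\<alpha> = 1" "\<beta> = 1"
    by auto
  with \<open>(1 / \<alpha> + 1 / \<beta>) * (a \<bullet> p) \<le> 2\<close> ge have "a \<bullet> p = 1"
    by simp
  have n: "a \<in> polar C" "- a \<in> polar C"
    using normals one by auto
  have dil1: "dilate 1 C = C"
    by (simp add: dilate_def)
  \<comment> \<open>Pairing \<open>b\<close> with \<open>- a\<close> in the description of
    \<open>H\<close> uses up \<open>a \<bullet> p = 1\<close> and leaves
    \<open>b \<bullet> p \<le> 1\<close> for every polar \<open>b\<close>, so \<open>p\<close> is in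
    the bipolar. For \<open>- p\<close>, \<open>a\<close> takes the role of
    \<open>- a\<close>.\<close>
  have "p \<in> dilate 1 C"
  proof (rule mem_dilate_if_polar_le)
    fix b assume "b \<in> polar C"
    with n(2) ap(2) have "(b - (- a)) \<bullet> p \<le> 2"
      unfolding H by blast
    with \<open>a \<bullet> p = 1\<close> show "b \<bullet> p \<le> 1"
      by (simp add: inner_add_left)
  qed (use \<open>closed C\<close> \<open>convex C\<close> \<open>0 \<in> C\<close> in auto)
  moreover have "- p \<in> dilate 1 C"
  proof (rule mem_dilate_if_polar_le)
    fix b assume "b \<in> polar C"
    with n(1) ap(2) have "(a - b) \<bullet> p \<le> 2"
      unfolding H by blast
    with \<open>a \<bullet> p = 1\<close> show "b \<bullet> (- p) \<le> 1"
      by (simp add: inner_diff_left)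
  qed (use \<open>closed C\<close> \<open>convex C\<close> \<open>0 \<in> C\<close> in auto)
  moreover have "\<bar>a \<bullet> x\<bar> \<le> 1" if "x \<in> C" for x
    using u(2)[OF that] v(2)[OF that] one by (simp add: \<alpha>_def \<beta>_def)
  ultimately show thesis
    using that[of p a] \<open>a \<bullet> p = 1\<close> dil1 by simp
qed

section \<open>Inequalities between contacts in the strip\<close>

text \<open>Both sides of the inequality arise from \<open>(\<beta>1 y1) (\<beta>2 y2) = (\<beta>1 y2) (\<beta>2 y1)\<close>: the left factors are known
  exactly, the right ones are negative and at least \<open>- r - \<alpha>1 x2\<close> and \<open>- r - \<alpha>2 x1\<close>.\<close>

lemma contact_pair_ineq:
  fixes r :: real
  assumes "0 < r" "r < 1"
    and eq: "\<alpha>1 * x1 + \<beta>1 * y1 = 1" "\<alpha>2 * x2 + \<beta>2 * y2 = 1"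
    and ge: "- r \<le> \<alpha>2 * x1 + \<beta>2 * y1" "- r \<le> \<alpha>1 * x2 + \<beta>1 * y2"
    and small: "\<bar>\<alpha>1\<bar> \<le> r" "\<bar>\<alpha>2\<bar> \<le> r" "\<bar>x1\<bar> \<le> 1" "\<bar>x2\<bar> \<le> 1"
    and sgn: "\<beta>1 > 0" "\<beta>2 < 0"
  shows "1 - r\<^sup>2 \<le> \<alpha>1 * (x1 + r * x2) + \<alpha>2 * (x2 + r * x1)" "y1 > 0" "y2 < 0"
proof -
  have "\<bar>\<alpha>1 * x1\<bar> \<le> r * 1" "\<bar>\<alpha>2 * x2\<bar> \<le> r * 1"
    unfolding abs_mult using small \<open>0 < r\<close> by (intro mult_mono; simp)+
  with eq \<open>r < 1\<close> have "\<beta>1 * y1 > 0" "\<beta>2 * y2 > 0"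
    by linarith+
  with sgn show y: "y1 > 0" "y2 < 0"
    by (auto simp: zero_less_mult_iff)
  have "\<beta>1 * y2 < 0" "\<beta>2 * y1 < 0"
    using sgn y by (auto simp: mult_less_0_iff)
  with ge have "(- (\<beta>1 * y2)) * (- (\<beta>2 * y1)) \<le> (r + \<alpha>1 * x2) * (r + \<alpha>2 * x1)"
    by (intro mult_mono) auto
  moreover have "(- (\<beta>1 * y2)) * (- (\<beta>2 * y1)) = (\<beta>1 * y1) * (\<beta>2 * y2)"
    by (simp add: algebra_simps)
  moreover have "\<beta>1 * y1 = 1 - \<alpha>1 * x1" "\<beta>2 * y2 = 1 - \<alpha>2 * x2"
    using eq by auto
  ultimately have "(1 - \<alpha>1 * x1) * (1 - \<alpha>2 * x2) \<le> (r + \<alpha>1 * x2) * (r + \<alpha>2 * x1)"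
    by simp
  then show "1 - r\<^sup>2 \<le> \<alpha>1 * (x1 + r * x2) + \<alpha>2 * (x2 + r * x1)"
    by (simp add: algebra_simps power2_eq_square)
qed

text \<open>The bounds \<open>s2\<close> and \<open>s3\<close> make
  \<open>r * \<alpha>1 + \<alpha>2\<close> and \<open>- \<alpha>3 - r * \<alpha>1\<close>
  nonnegative, so \<open>x2\<close> and \<open>x3\<close> may be replaced by the extremes
  \<open>1\<close> and \<open>-1\<close>. For \<open>x1 \<ge> 0\<close>, \<open>i3\<close> then
  squeezes everything between \<open>1 - r\<^sup>2\<close> and \<open>r\<close>; for
  \<open>x1 < 0\<close> a contradiction results.\<close>

lemma contact_normals_rigid:
  fixes r :: real
  assumes r: "0 < r" "r\<^sup>2 + r \<le> 1"
    and a: "0 \<le> \<alpha>1" "\<bar>\<alpha>1\<bar> \<le> r" "\<bar>\<alpha>2\<bar> \<le> r" "\<bar>\<alpha>3\<bar> \<le> r"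
    and x: "\<bar>x1\<bar> \<le> 1" "\<bar>x2\<bar> \<le> 1" "\<bar>x3\<bar> \<le> 1"
    and i2: "1 - r\<^sup>2 \<le> \<alpha>1 * (x1 + r * x2) + \<alpha>2 * (x2 + r * x1)"
    and i3: "1 - r\<^sup>2 \<le> \<alpha>1 * (x1 + r * x3) + \<alpha>3 * (x3 + r * x1)"
    and s2: "- \<alpha>2 \<le> r * \<alpha>1" and s3: "\<alpha>1 \<le> r * (- \<alpha>3)"
  shows "r\<^sup>2 + r = 1 \<and> \<alpha>1 = 0 \<and> \<alpha>2 = r \<and> \<alpha>3 = - r \<and> x1 = 0 \<and> x2 = 1 \<and> x3 = -1"
proof -
  define b where "b = - \<alpha>3"
  have "r < 1" using r by (smt (verit) zero_less_power2)
  have b: "b \<le> r" "\<alpha>1 \<le> r * b"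
    using a s3 by (auto simp: b_def)
  have "0 \<le> r * b"
    using b a by linarith
  then have "0 \<le> b"
    using r by (simp add: zero_le_mult_iff)
  note b = this b
  have rb: "r * b \<le> b" "r * \<alpha>1 \<le> \<alpha>1"
    using mult_right_mono[of r 1 b] mult_right_mono[of r 1 \<alpha>1] b a r \<open>r < 1\<close>
    by simp_all
  have k3: "(b - r * \<alpha>1) * (- x3) \<le> (b - r * \<alpha>1) * 1"
    using rb b x by (intro mult_left_mono) auto
  have j3: "1 - r\<^sup>2 \<le> (b - r * \<alpha>1) * (- x3) - x1 * (r * b - \<alpha>1)"
    using i3 by (simp add: b_def algebra_simps)
  have x1: "x1 = 0 \<and> \<alpha>1 = 0 \<and> b = r"
  proof (cases "x1 \<ge> 0")
    case True
    then have "0 \<le> x1 * (r * b - \<alpha>1)" using b by simp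
    moreover have "0 \<le> r * \<alpha>1" using r a by simp
    moreover have "1 - r\<^sup>2 \<le> b - r * \<alpha>1 - x1 * (r * b - \<alpha>1)"
      using j3 k3 by simp
    ultimately have "b = r" and "r * \<alpha>1 = 0" and "x1 * (r * b - \<alpha>1) = 0"
      using r(2) b(2) by linarith+
    then show ?thesis using r by auto
  next
    case False
    then have n: "x1 < 0" "0 \<le> - x1" "- x1 \<le> 1" using x by auto
    show ?thesis
    proof (cases "\<alpha>2 \<ge> 0")
      case True
      have "(r * \<alpha>1 + \<alpha>2) * x2 \<le> (r * \<alpha>1 + \<alpha>2) * 1"
        using x True a r by (intro mult_left_mono) auto
      then have j2: "1 - r\<^sup>2 \<le> r * \<alpha>1 + \<alpha>2 * (1 + r * x1) + \<alpha>1 * x1"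
        using i2 by (simp add: algebra_simps)
      have "r * (- x1) \<le> r * 1" using r n by (intro mult_left_mono) auto
      then have "0 \<le> 1 + r * x1" using \<open>r < 1\<close> by simp
      then have "\<alpha>2 * (1 + r * x1) \<le> r * (1 + r * x1)"
        using a by (intro mult_right_mono) auto
      with j2 have l2: "1 - r\<^sup>2 \<le> r * \<alpha>1 + r + r\<^sup>2 * x1 + \<alpha>1 * x1"
        by (simp add: algebra_simps power2_eq_square)
      have "b * (1 - r * x1) \<le> r * (1 - r * x1)"
        using b \<open>r * (- x1) \<le> r * 1\<close> n r by (intro mult_right_mono) (auto intro: order_trans[OF mult_nonneg_nonpos])
      with j3 k3 have l3: "1 - r\<^sup>2 \<le> r - r * \<alpha>1 - r\<^sup>2 * x1 + \<alpha>1 * x1"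
        by (simp add: algebra_simps power2_eq_square)
      have "\<alpha>1 * x1 \<le> 0" using a n by (simp add: mult_nonneg_nonpos)
      \<comment> \<open>Adding \<open>l2\<close> and \<open>l3\<close> cancels the terms in
        \<open>r * \<alpha>1\<close> and \<open>r\<^sup>2 * x1\<close>; with
        \<open>r \<le> 1 - r\<^sup>2\<close> this leaves
        \<open>0 \<le> \<alpha>1 * x1\<close>.\<close>
      with l2 l3 r have "\<alpha>1 * x1 = 0" by linarith
      with n have "\<alpha>1 = 0" by auto
      with l2 r have "0 \<le> r\<^sup>2 * x1" by simp
      with n r show ?thesis by (simp add: zero_le_mult_iff)
    next
      case False
      \<comment> \<open>This case is empty: the right side of \<open>i2\<close> is strictly below
        \<open>r\<close>, hence below \<open>1 - r\<^sup>2\<close>.\<close>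
      have "(r * \<alpha>1 + \<alpha>2) * x2 \<le> (r * \<alpha>1 + \<alpha>2) * 1"
        using x s2 by (intro mult_left_mono) auto
      moreover have "\<alpha>1 * x1 \<le> 0" using a n by (simp add: mult_nonneg_nonpos)
      moreover have "r * ((- \<alpha>2) * (- x1)) \<le> r * ((- \<alpha>2) * 1)"
        using r n False by (intro mult_left_mono) auto
      ultimately have "1 - r\<^sup>2 \<le> r * \<alpha>1 + \<alpha>2 - r * \<alpha>2"
        using i2 by (simp add: algebra_simps)
      also have "\<dots> = r * \<alpha>1 + (1 - r) * \<alpha>2" by (simp add: algebra_simps)
      also have "\<dots> < r * \<alpha>1" using False \<open>r < 1\<close> by (simp add: mult_pos_neg)
      also have "\<dots> \<le> r * r" using a r by (intro mult_left_mono) auto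
      also have "\<dots> \<le> r * 1" using r \<open>r < 1\<close> by (intro mult_left_mono) auto
      finally show ?thesis using r by simp
    qed
  qed
  have e3: "1 - r\<^sup>2 \<le> r * (- x3)" using j3 x1 by simp
  have "r * (- x3) \<le> r * 1" using x r by (intro mult_left_mono) auto
  with e3 r have r1: "r\<^sup>2 + r = 1" and "r * (- x3) = r * 1" by linarith+
  from this(2) have "x3 = -1" using r(1) by (simp only: mult_cancel_left) simp
  have a2: "0 \<le> \<alpha>2" using s2 x1 by simp
  have "1 - r\<^sup>2 \<le> \<alpha>2 * x2" using i2 x1 by simp
  moreover have "\<alpha>2 * x2 \<le> \<alpha>2 * 1" using x a2 by (intro mult_left_mono) auto
  ultimately have "\<alpha>2 = r" using a r1 by linarith
  moreover have "x2 = 1"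
    using \<open>1 - r\<^sup>2 \<le> \<alpha>2 * x2\<close> \<open>\<alpha>2 = r\<close> r1 r x by (smt (verit) mult_less_cancel_left2)
  ultimately show ?thesis using r1 x1 \<open>x3 = -1\<close> by (simp add: b_def)
qed

section \<open>The planar normal form\<close>

text \<open>A planar set is given by its membership predicate \<open>P\<close>. The golden house is the case
  \<open>r = 1 / golden_ratio\<close> and \<open>\<kappa> = r\<close>; its two base vertices and its ridge occur explicitly, while the
  eaves \<open>(\<plusminus>1, 0)\<close> and the walls \<open>\<bar>x\<bar> \<le> 1\<close> are left to the context.\<close>

definition planar_house :: "(real \<Rightarrow> real \<Rightarrow> bool) \<Rightarrow> real \<Rightarrow> bool" where
  "planar_house P r \<longleftrightarrow> (\<exists>\<kappa>. \<kappa> \<noteq> 0 \<and> P 0 (1 / \<kappa>) \<and> P 1 (- r / \<kappa>) \<and> P (-1) (- r / \<kappa>) \<and>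
     (\<forall>x y. P x y \<longrightarrow> - r \<le> \<kappa> * y \<and> \<kappa> * y \<le> 1 + x \<and> \<kappa> * y \<le> 1 - x))"

text \<open>\<open>(x, y)\<close> is a point where \<open>P\<close> touches \<open>- P / r\<close>, and \<open>(\<alpha>, \<beta>)\<close> is an outer normal there.\<close>

definition contact :: "(real \<Rightarrow> real \<Rightarrow> bool) \<Rightarrow> real \<Rightarrow> real \<Rightarrow> real \<Rightarrow> real \<Rightarrow> real \<Rightarrow> bool" where
  "contact P r \<alpha> \<beta> x y \<longleftrightarrow> P x y \<and> \<alpha> * x + \<beta> * y = 1 \<and> (\<forall>x y. P x y \<longrightarrow> - r \<le> \<alpha> * x + \<beta> * y)"

text \<open>The case left after using the symmetries. The cross products in \<open>ord\<close> put
  normals 2 and 3 on opposite sides of the line through normal 1; combined with the contacts, this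
  yields the slope bounds of \<open>contact_normals_rigid\<close>.\<close>

lemma planar_house_ordered:
  assumes r: "0 < r" "r\<^sup>2 + r \<le> 1"
    and P: "P 1 0" "P (-1) 0" "\<forall>x y. P x y \<longrightarrow> \<bar>x\<bar> \<le> 1"
    and c: "contact P r \<alpha>1 \<beta>1 x1 y1" "contact P r \<alpha>2 \<beta>2 x2 y2" "contact P r \<alpha>3 \<beta>3 x3 y3"
    and sgn: "\<beta>1 > 0" "\<beta>2 < 0" "\<beta>3 < 0" "0 \<le> \<alpha>1"
    and ord: "\<alpha>1 * \<beta>2 \<le> \<alpha>2 * \<beta>1" "\<alpha>3 * \<beta>1 \<le> \<alpha>1 * \<beta>3"
  shows "r\<^sup>2 + r = 1 \<and> planar_house P r"
proof -
  have "r < 1" using r by (smt (verit) zero_less_power2)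
  have Pi: "P x1 y1" "P x2 y2" "P x3 y3"
    using c by (auto simp: contact_def)
  have eq: "\<alpha>1 * x1 + \<beta>1 * y1 = 1" "\<alpha>2 * x2 + \<beta>2 * y2 = 1" "\<alpha>3 * x3 + \<beta>3 * y3 = 1"
    using c by (auto simp: contact_def)
  have ge: "- r \<le> \<alpha>1 * x + \<beta>1 * y" "- r \<le> \<alpha>2 * x + \<beta>2 * y" "- r \<le> \<alpha>3 * x + \<beta>3 * y"
    if "P x y" for x y
    using c that by (auto simp: contact_def)
  have a: "\<bar>\<alpha>1\<bar> \<le> r" "\<bar>\<alpha>2\<bar> \<le> r" "\<bar>\<alpha>3\<bar> \<le> r"
    using ge[OF P(1)] ge[OF P(2)] by auto
  have x: "\<bar>x1\<bar> \<le> 1" "\<bar>x2\<bar> \<le> 1" "\<bar>x3\<bar> \<le> 1"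
    using P(3) Pi by auto
  note i2 = contact_pair_ineq[OF r(1) \<open>r < 1\<close> eq(1,2) ge(2)[OF Pi(1)] ge(1)[OF Pi(2)]
      a(1,2) x(1,2) sgn(1,2)]
  note i3 = contact_pair_ineq[OF r(1) \<open>r < 1\<close> eq(1,3) ge(3)[OF Pi(1)] ge(1)[OF Pi(3)]
      a(1,3) x(1,3) sgn(1,3)]
  \<comment> \<open>The bound of normal 1 at contact 3 is multiplied by \<open>- \<alpha>3\<close>.
    Then \<open>ord\<close> trades \<open>- \<alpha>3 * \<beta>1\<close> for
    \<open>- \<alpha>1 * \<beta>3\<close>, contact 3 eliminates \<open>y3\<close>, and the terms in
    \<open>x3\<close> cancel. For \<open>s2\<close>, normal 2 at contact 1 is treated likewise with
    factor \<open>\<alpha>1\<close>.\<close>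
  have s3: "\<alpha>1 \<le> r * (- \<alpha>3)"
  proof -
    have "\<alpha>3 * \<beta>1 \<le> 0"
      using ord(2) sgn by (smt (verit) mult_nonneg_nonpos)
    then have "0 \<le> - \<alpha>3"
      using sgn by (simp add: mult_le_0_iff)
    then have "(- \<alpha>3) * (\<beta>1 * (- y3)) \<le> (- \<alpha>3) * (r + \<alpha>1 * x3)"
      using ge(1)[OF Pi(3)] by (intro mult_left_mono) auto
    moreover have "(\<alpha>1 * (- \<beta>3)) * (- y3) \<le> ((- \<alpha>3) * \<beta>1) * (- y3)"
      using ord(2) i3(3) by (intro mult_right_mono) auto
    moreover have "(\<alpha>1 * (- \<beta>3)) * (- y3) = \<alpha>1 * (1 - \<alpha>3 * x3)"
      using eq(3) by (simp add: algebra_simps flip: eq(3))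
    ultimately show ?thesis
      by (simp add: algebra_simps)
  qed
  have s2: "- \<alpha>2 \<le> r * \<alpha>1"
  proof -
    have "\<alpha>1 * (- (\<beta>2 * y1)) \<le> \<alpha>1 * (r + \<alpha>2 * x1)"
      using ge(2)[OF Pi(1)] sgn by (intro mult_left_mono) auto
    moreover have "(- \<alpha>2 * \<beta>1) * y1 \<le> (\<alpha>1 * (- \<beta>2)) * y1"
      using ord(1) i2(2) by (intro mult_right_mono) auto
    moreover have "(- \<alpha>2 * \<beta>1) * y1 = - \<alpha>2 * (1 - \<alpha>1 * x1)"
      using eq(1) by (simp add: algebra_simps flip: eq(1))
    ultimately show ?thesis
      by (simp add: algebra_simps)
  qed
  from contact_normals_rigid[OF r sgn(4) a x i2(1) i3(1) s2 s3]
  have r1: "r\<^sup>2 + r = 1" and v: "\<alpha>1 = 0" "\<alpha>2 = r" "\<alpha>3 = - r" "x1 = 0" "x2 = 1" "x3 = -1"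
    by auto
  have y1: "\<beta>1 * y1 = 1" using eq v by simp
  \<comment> \<open>The product of \<open>- (\<beta>1 * y)\<close> and
    \<open>- (\<beta> * y1)\<close> is \<open>1 - r = r\<^sup>2\<close>, while each factor is at
    most \<open>r\<close>; hence both equal \<open>r\<close>.\<close>
  have tight: "\<beta> = - r * \<beta>1 \<and> \<beta>1 * y = - r"
    if "\<beta> * y = 1 - r" "- r \<le> \<beta> * y1" "- r \<le> \<beta>1 * y" "y < 0" for \<beta> y
  proof -
    have pr: "(- (\<beta>1 * y)) * (- (\<beta> * y1)) = r * r"
      using that(1) r1 y1 by algebra
    have pos: "0 < - (\<beta>1 * y)"
      using that(4) sgn by (simp add: mult_pos_neg)
    have "(- (\<beta>1 * y)) * (- (\<beta> * y1)) \<le> (- (\<beta>1 * y)) * r"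
      using that pos by (intro mult_left_mono) auto
    then have "r * r \<le> (- (\<beta>1 * y)) * r"
      using pr by linarith
    then have "r \<le> - (\<beta>1 * y)"
      using r(1) by (simp only: mult_le_cancel_right_pos)
    with that(3) have y: "\<beta>1 * y = - r"
      by simp
    with pr have "r * (- (\<beta> * y1)) = r * r"
      by simp
    with r(1) have "\<beta> * y1 = - r"
      by (simp only: mult_cancel_left) simp
    moreover have "\<beta> = (\<beta> * y1) * \<beta>1"
      using y1 by (simp add: algebra_simps)
    ultimately show ?thesis
      using y by simp
  qed
  have b2: "\<beta>2 = - r * \<beta>1" "\<beta>1 * y2 = - r"
    using tight[of \<beta>2 y2] eq(2) ge(2)[OF Pi(1)] ge(1)[OF Pi(2)] i2(3) v by auto
  have b3: "\<beta>3 = - r * \<beta>1" "\<beta>1 * y3 = - r"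
    using tight[of \<beta>3 y3] eq(3) ge(3)[OF Pi(1)] ge(1)[OF Pi(3)] i3(3) v by auto
  have "y1 = 1 / \<beta>1" "y2 = - r / \<beta>1" "y3 = - r / \<beta>1"
    using y1 b2(2) b3(2) sgn(1) by (simp_all add: field_simps del: mult_minus_left)
  \<comment> \<open>With all normals known, normal 1 bounds the floor, and normals 2 and 3, divided
    by \<open>r\<close>, bound the two roof slopes.\<close>
  moreover have "- r \<le> \<beta>1 * y \<and> \<beta>1 * y \<le> 1 + x \<and> \<beta>1 * y \<le> 1 - x" if "P x y" for x y
  proof -
    have "r * (\<beta>1 * y) \<le> r * (1 + x)" "r * (\<beta>1 * y) \<le> r * (1 - x)"
      using ge[OF that] v b2 b3 by (simp_all add: algebra_simps)
    with ge(1)[OF that] v r(1) show ?thesis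
      by (simp only: mult_le_cancel_left_pos) simp
  qed
  ultimately show ?thesis
    using Pi v sgn(1) r1 unfolding planar_house_def by (intro conjI exI[of _ \<beta>1]) auto
qed

lemma planar_house_reflect_x:
  assumes "planar_house (\<lambda>x y. P (- x) y) r"
  shows "planar_house P r"
proof -
  obtain \<kappa> where \<kappa>: "\<kappa> \<noteq> 0" "P 0 (1 / \<kappa>)" "P 1 (- r / \<kappa>)" "P (-1) (- r / \<kappa>)"
    "\<forall>x y. P (- x) y \<longrightarrow> - r \<le> \<kappa> * y \<and> \<kappa> * y \<le> 1 + x \<and> \<kappa> * y \<le> 1 - x"
    using assms unfolding planar_house_def by auto
  then have "- r \<le> \<kappa> * y \<and> \<kappa> * y \<le> 1 + x \<and> \<kappa> * y \<le> 1 - x" if "P x y" for x y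
    using that \<kappa>(5)[rule_format, of "- x" y] by simp
  with \<kappa> show ?thesis
    unfolding planar_house_def by blast
qed

lemma planar_house_reflect_y:
  assumes "planar_house (\<lambda>x y. P x (- y)) r"
  shows "planar_house P r"
proof -
  obtain \<kappa> where \<kappa>: "\<kappa> \<noteq> 0" "P 0 (- (1 / \<kappa>))" "P 1 (- (- r / \<kappa>))" "P (-1) (- (- r / \<kappa>))"
    "\<forall>x y. P x (- y) \<longrightarrow> - r \<le> \<kappa> * y \<and> \<kappa> * y \<le> 1 + x \<and> \<kappa> * y \<le> 1 - x"
    using assms unfolding planar_house_def by auto
  then have "- r \<le> - \<kappa> * y \<and> - \<kappa> * y \<le> 1 + x \<and> - \<kappa> * y \<le> 1 - x" if "P x y" for x y
    using that \<kappa>(5)[rule_format, of x "- y"] by simp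
  with \<kappa> show ?thesis
    unfolding planar_house_def by (intro exI[of _ "- \<kappa>"]) simp
qed

lemma contact_reflect_x:
  "contact P r \<alpha> \<beta> x y \<Longrightarrow> contact (\<lambda>x y. P (- x) y) r (- \<alpha>) \<beta> (- x) y"
  unfolding contact_def by fastforce

lemma contact_reflect_y:
  "contact P r \<alpha> \<beta> x y \<Longrightarrow> contact (\<lambda>x y. P x (- y)) r \<alpha> (- \<beta>) x (- y)"
  unfolding contact_def by fastforce

lemma opposite_signs_if_balanced:
  fixes u v X Y :: real
  assumes "0 \<le> u" "0 \<le> v" "0 < u + v" "u * X + v * Y = 0"
  shows "0 \<le> X \<and> Y \<le> 0 \<or> X \<le> 0 \<and> 0 \<le> Y"
proof -
  have False if "0 < X" "0 < Y" "u * X + v * Y = 0" for X Y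
  proof -
    have "0 \<le> u * X" "0 \<le> v * Y"
      using assms that by auto
    with that(3) have "u * X = 0" "v * Y = 0"
      by linarith+
    with assms(3) that show False
      by simp
  qed
  from this[of X Y] this[of "- X" "- Y"] assms(4) show ?thesis
    by (cases "0 < X"; cases "0 < Y"; cases "X < 0"; cases "Y < 0") auto
qed

text \<open>Eliminating \<open>w1\<close> from the balance equations leaves a balance of the cross
  products with normal 1, so these have opposite signs. Swapping contacts 2 and 3 fixes their order,
  and the reflection in \<open>x\<close> makes \<open>\<alpha>1\<close> nonnegative.\<close>

lemma planar_house_signed:
  assumes r: "0 < r" "r\<^sup>2 + r \<le> 1"
    and P: "P 1 0" "P (-1) 0" "\<forall>x y. P x y \<longrightarrow> \<bar>x\<bar> \<le> 1"
    and c: "contact P r \<alpha>1 \<beta>1 x1 y1" "contact P r \<alpha>2 \<beta>2 x2 y2" "contact P r \<alpha>3 \<beta>3 x3 y3"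
    and sgn: "\<beta>1 > 0" "\<beta>2 < 0" "\<beta>3 < 0"
    and w: "0 \<le> w1" "0 \<le> w2" "0 \<le> w3" "w1 + w2 + w3 = 1"
      "w1 * \<alpha>1 + w2 * \<alpha>2 + w3 * \<alpha>3 = 0" "w1 * \<beta>1 + w2 * \<beta>2 + w3 * \<beta>3 = 0"
  shows "r\<^sup>2 + r = 1 \<and> planar_house P r"
proof -
  have bal: "w2 * (\<alpha>2 * \<beta>1 - \<alpha>1 * \<beta>2) + w3 * (\<alpha>3 * \<beta>1 - \<alpha>1 * \<beta>3) = 0"
    using w(5,6) by algebra
  have "w2 + w3 > 0"
  proof (rule ccontr)
    assume "\<not> w2 + w3 > 0"
    with w(2-4) have "w2 = 0" "w3 = 0" "w1 = 1"
      by linarith+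
    with w(6) sgn(1) show False
      by simp
  qed
  from opposite_signs_if_balanced[OF w(2,3) this bal]
  have ord: "\<alpha>1 * \<beta>2 \<le> \<alpha>2 * \<beta>1 \<and> \<alpha>3 * \<beta>1 \<le> \<alpha>1 * \<beta>3 \<or>
      \<alpha>1 * \<beta>3 \<le> \<alpha>3 * \<beta>1 \<and> \<alpha>2 * \<beta>1 \<le> \<alpha>1 * \<beta>2"
    by auto
  show ?thesis
  proof (cases "\<alpha>1 \<ge> 0")
    case True
    then show ?thesis
      using ord planar_house_ordered[OF r P c sgn] planar_house_ordered[OF r P c(1,3,2) sgn(1,3,2)]
      by blast
  next
    case False
    let ?P = "\<lambda>x y. P (- x) y"
    have P': "?P 1 0" "?P (-1) 0" "\<forall>x y. ?P x y \<longrightarrow> \<bar>x\<bar> \<le> 1"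
      using P(1,2) P(3)[rule_format, of "- _"] by auto
    note c' = c[THEN contact_reflect_x]
    show ?thesis
      using ord False planar_house_reflect_x[of P r]
        planar_house_ordered[OF r P' c' sgn] planar_house_ordered[OF r P' c'(1,3,2) sgn(1,3,2)]
      by auto
  qed
qed

lemma planar_house_if_balanced_contacts:
  assumes r: "0 < r" "r\<^sup>2 + r \<le> 1"
    and P: "P 1 0" "P (-1) 0" "\<forall>x y. P x y \<longrightarrow> \<bar>x\<bar> \<le> 1"
    and c: "contact P r \<alpha>1 \<beta>1 x1 y1" "contact P r \<alpha>2 \<beta>2 x2 y2" "contact P r \<alpha>3 \<beta>3 x3 y3"
    and w: "0 \<le> w1" "0 \<le> w2" "0 \<le> w3" "w1 + w2 + w3 = 1"
      "w1 * \<alpha>1 + w2 * \<alpha>2 + w3 * \<alpha>3 = 0" "w1 * \<beta>1 + w2 * \<beta>2 + w3 * \<beta>3 = 0"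
  shows "r\<^sup>2 + r = 1 \<and> planar_house P r"
proof -
  have "r < 1" using r by (smt (verit) zero_less_power2)
  \<comment> \<open>A horizontal normal would need
    \<open>\<bar>\<alpha>\<bar> * \<bar>x\<bar> = 1\<close>, but the points
    \<open>(\<plusminus>1, 0)\<close> force \<open>\<bar>\<alpha>\<bar> \<le> r < 1\<close>.\<close>
  have nz: "\<beta> \<noteq> 0" if "contact P r \<alpha> \<beta> x y" for \<alpha> \<beta> x y
  proof
    assume "\<beta> = 0"
    with that have "\<alpha> * x = 1" "\<bar>x\<bar> \<le> 1" "- r \<le> \<alpha> * 1 + \<beta> * 0" "- r \<le> \<alpha> * (-1) + \<beta> * 0"
      using P unfolding contact_def by auto
    then have "\<bar>\<alpha>\<bar> * \<bar>x\<bar> = 1" "\<bar>\<alpha>\<bar> \<le> r" "\<bar>x\<bar> \<le> 1"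
      by (auto simp flip: abs_mult)
    moreover have "\<bar>\<alpha>\<bar> * \<bar>x\<bar> \<le> r * 1"
      using calculation by (intro mult_mono) auto
    ultimately show False
      using \<open>r < 1\<close> by simp
  qed
  let ?P = "\<lambda>x y. P x (- y)"
  have P': "?P 1 0" "?P (-1) 0" "\<forall>x y. ?P x y \<longrightarrow> \<bar>x\<bar> \<le> 1"
    using P by auto
  note c' = c[THEN contact_reflect_y]
  have w': "w1 * - \<beta>1 + w2 * - \<beta>2 + w3 * - \<beta>3 = 0"
    using w(6) by simp
  have mixed: False if "\<beta>1 * s > 0" "\<beta>2 * s > 0" "\<beta>3 * s > 0" for s
  proof -
    have "w1 * (\<beta>1 * s) + w2 * (\<beta>2 * s) + w3 * (\<beta>3 * s) = 0"
      using w(6) by algebra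
    moreover have "0 \<le> w1 * (\<beta>1 * s)" "0 \<le> w2 * (\<beta>2 * s)" "0 \<le> w3 * (\<beta>3 * s)"
      using w that by auto
    ultimately have "w1 * (\<beta>1 * s) = 0" "w2 * (\<beta>2 * s) = 0" "w3 * (\<beta>3 * s) = 0"
      by linarith+
    with that w(4) show False by auto
  qed
  \<comment> \<open>Normals all pointing up or all down cannot balance, so exactly one is alone on
    its side; the cases record which one and on which side.\<close>
  consider "\<beta>1 > 0" "\<beta>2 < 0" "\<beta>3 < 0" | "\<beta>2 > 0" "\<beta>1 < 0" "\<beta>3 < 0" | "\<beta>3 > 0" "\<beta>2 < 0" "\<beta>1 < 0"
    | "- \<beta>1 > 0" "- \<beta>2 < 0" "- \<beta>3 < 0" | "- \<beta>2 > 0" "- \<beta>1 < 0" "- \<beta>3 < 0"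
    | "- \<beta>3 > 0" "- \<beta>2 < 0" "- \<beta>1 < 0"
    using nz[OF c(1)] nz[OF c(2)] nz[OF c(3)] mixed[of 1, simplified] mixed[of "-1", simplified]
    by (cases "\<beta>1 > 0"; cases "\<beta>2 > 0"; cases "\<beta>3 > 0") auto
  then show ?thesis
  proof cases
    case 1
    then show ?thesis using planar_house_signed[OF r P c _ _ _ w] by blast
  next
    case 2
    then show ?thesis
      using planar_house_signed[OF r P c(2,1,3) _ _ _ w(2,1,3)] w(4-6) by (simp add: add_ac)
  next
    case 3
    then show ?thesis
      using planar_house_signed[OF r P c(3,2,1) _ _ _ w(3,2,1)] w(4-6) by (simp add: add_ac)
  next
    case 4
    then show ?thesis
      using planar_house_signed[OF r P' c' _ _ _ w(1-5) w'] planar_house_reflect_y[of P r] by blast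
  next
    case 5
    then show ?thesis
      using planar_house_signed[OF r P' c'(2,1,3) _ _ _ w(2,1,3)] w(4,5) w'
        planar_house_reflect_y[of P r] by (simp add: add_ac)
  next
    case 6
    then show ?thesis
      using planar_house_signed[OF r P' c'(3,2,1) _ _ _ w(3,2,1)] w(4,5) w'
        planar_house_reflect_y[of P r] by (simp add: add_ac)
  qed
qed

section \<open>The golden house and balanced triples\<close>

lemma golden_ratio_pos: "golden_ratio > 1"
  and golden_ratio_sq: "golden_ratio\<^sup>2 = golden_ratio + 1"
proof -
  have "1 < sqrt (5::real)"
    using real_sqrt_less_mono[of 1 5] by simp
  then show "golden_ratio > 1"
    by (simp add: golden_ratio_def)
  have "(sqrt 5)\<^sup>2 = (5::real)" by simp
  then show "golden_ratio\<^sup>2 = golden_ratio + 1"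
    by (simp add: golden_ratio_def power2_eq_square field_simps)
qed

text \<open>Points below height \<open>0\<close> mix the floor with the segment joining the eaves;
  points above mix that segment with the ridge.\<close>

lemma golden_house_eq_if_inequalities:
  fixes K :: "(real ^ 2) set"
  assumes "convex K"
    and vert: "vector [1, 0] \<in> K" "vector [-1, 0] \<in> K" "vector [0, golden_ratio] \<in> K"
      "vector [1, -1] \<in> K" "vector [-1, -1] \<in> K"
    and ineq: "\<And>z. z \<in> K \<Longrightarrow> \<bar>z $ 1\<bar> \<le> 1 \<and> -1 \<le> z $ 2 \<and>
      z $ 2 \<le> golden_ratio * (1 + z $ 1) \<and> z $ 2 \<le> golden_ratio * (1 - z $ 1)"
  shows "K = golden_house"
proof
  have conv: "convex golden_house"
    by (simp add: golden_house_def)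
  have mem: "vector [1, 0] \<in> golden_house" "vector [-1, 0] \<in> golden_house"
    "vector [0, golden_ratio] \<in> golden_house"
    "vector [1, -1] \<in> golden_house" "vector [-1, -1] \<in> golden_house"
    unfolding golden_house_def by (auto intro: hull_inc)
  have row: "vector [x, h] \<in> golden_house"
    if "\<bar>x\<bar> \<le> 1" "vector [1, h] \<in> golden_house" "vector [-1, h] \<in> golden_house" for x h
  proof -
    have "((1 + x) / 2) *\<^sub>R vector [1, h] + ((1 - x) / 2) *\<^sub>R vector [-1, h] \<in> golden_house"
      using that by (intro convexD[OF conv]) (auto simp: field_simps)
    moreover have "((1 + x) / 2) *\<^sub>R vector [1, h] + ((1 - x) / 2) *\<^sub>R vector [-1, h] =
        (vector [x, h] :: real ^ 2)"
      by (simp add: vec_eq_iff forall_2 field_simps)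
    ultimately show ?thesis
      by simp
  qed
  show "K \<subseteq> golden_house"
  proof
    fix z assume "z \<in> K"
    note z = ineq[OF this]
    let ?g = golden_ratio
    show "z \<in> golden_house"
    proof (cases "z $ 2 \<le> 0")
      case True
      have "(- z $ 2) *\<^sub>R vector [z $ 1, -1] + (1 + z $ 2) *\<^sub>R vector [z $ 1, 0] \<in> golden_house"
        using z True row[OF _ mem(1,2)] row[OF _ mem(4,5)] by (intro convexD[OF conv]) auto
      also have "(- z $ 2) *\<^sub>R vector [z $ 1, -1] + (1 + z $ 2) *\<^sub>R vector [z $ 1, 0] = z"
        by (simp add: vec_eq_iff forall_2 algebra_simps)
      finally show ?thesis .
    next
      case False
      \<comment> \<open>\<open>m\<close> is the weight of the ridge. The point on the eaves segment
        involves division by \<open>1 - m\<close>, so the ridge itself is treated apart.\<close>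
      define m where "m = z $ 2 / ?g"
      have m: "0 < m" "m \<le> 1 + z $ 1" "m \<le> 1 - z $ 1" "z $ 2 = m * ?g"
        using z False golden_ratio_pos by (auto simp: m_def divide_le_eq mult.commute)
      show ?thesis
      proof (cases "m = 1")
        case True
        with m have "z = vector [0, ?g]"
          by (simp add: vec_eq_iff forall_2)
        with mem show ?thesis by simp
      next
        case False
        with m have "m < 1" by linarith
        have "(1 - m) *\<^sub>R vector [z $ 1 / (1 - m), 0] + m *\<^sub>R vector [0, ?g] \<in> golden_house"
          using m \<open>m < 1\<close> mem(3) row[OF _ mem(1,2), of "z $ 1 / (1 - m)"]
          by (intro convexD[OF conv]) (auto simp: abs_le_iff divide_le_eq)
        also have "(1 - m) *\<^sub>R vector [z $ 1 / (1 - m), 0] + m *\<^sub>R vector [0, ?g] = z"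
          using m \<open>m < 1\<close> by (simp add: vec_eq_iff forall_2)
        finally show ?thesis .
      qed
    qed
  qed
  show "golden_house \<subseteq> K"
    unfolding golden_house_def using assms by (intro hull_minimal) auto
qed

text \<open>Caratheodory in the plane gives at most three points; smaller families are padded by
  repeating a point with weight \<open>0\<close>.\<close>

lemma balanced_triple_if_zero_mem_hull:
  fixes N :: "(real ^ 2) set"
  assumes "0 \<in> convex hull N"
  obtains a1 a2 a3 w1 w2 w3 where "a1 \<in> N" "a2 \<in> N" "a3 \<in> N" "0 \<le> w1" "0 \<le> w2" "0 \<le> w3"
    "w1 + w2 + w3 = 1" "w1 *\<^sub>R a1 + w2 *\<^sub>R a2 + w3 *\<^sub>R a3 = 0"
proof -
  obtain S u where S: "finite S" "S \<subseteq> N" "card S \<le> 3" "\<forall>x\<in>S. 0 \<le> u x" "sum u S = 1"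
    "(\<Sum>v\<in>S. u v *\<^sub>R v) = 0"
    using assms unfolding convex_hull_caratheodory by auto
  have "S \<noteq> {}" using S(5) by auto
  with S(1,3) consider "card S = 1" | "card S = 2" | "card S = 3"
    by (metis One_nat_def Suc_1 card_eq_0_iff le_Suc_eq le_zero_eq numeral_3_eq_3)
  then show thesis
  proof cases
    case 1
    then obtain a where "S = {a}" by (auto simp: card_Suc_eq)
    with S that[of a a a 1 0 0] show ?thesis by auto
  next
    case 2
    then obtain a b where "S = {a, b}" "a \<noteq> b" by (auto simp: card_2_iff)
    with S that[of a b b "u a" "u b" 0] show ?thesis by auto
  next
    case 3
    then obtain a b c where "S = {a, b, c}" "a \<noteq> b" "a \<noteq> c" "b \<noteq> c" by (auto simp: card_3_iff)
    with S that[of a b c "u a" "u b" "u c"] show ?thesis by (auto simp: add_ac)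
  qed
qed

section \<open>Passage to coordinates and conclusion\<close>

theorem theorem1p2:
  fixes C :: "(real ^ 2) set"
  assumes "convex_body C"
    and "mink_centered C"
    and "opt_contained
           (polar (dilate (1/2) (mink_diff (polar C) (polar C))))
           (dilate (1/2) (mink_diff C C))"
  shows "mink_asymmetry C \<le> golden_ratio \<and>
         (mink_asymmetry C = golden_ratio \<longrightarrow>
           (\<exists>L :: real ^ 2 \<Rightarrow> real ^ 2. linear L \<and> bij L \<and> L ` C = golden_house))"
proof (cases "mink_asymmetry C < golden_ratio")
  \<comment> \<open>From \<open>s\<close> at least the golden ratio, equality and the shape are
    derived together, which settles both claims.\<close>
  case False
  let ?g = golden_ratio
  define s where "s = mink_asymmetry C"
  define r where "r = 1 / s"
  have s: "s \<ge> ?g" "s > 1" "s > 0"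
    using False golden_ratio_pos by (auto simp: s_def)
  have C: "compact C" "convex C"
    using assms(1) by (auto simp: convex_body_def)
  have "C \<subseteq> dilate (- s) C"
    using assms(2) by (simp add: mink_centered_iff s_def)
  then have "0 \<in> interior C"
    using zero_mem_interior_if_subset_reflection assms(1) s(3) by blast
  obtain p a where p: "p \<in> C" "- p \<in> C" "a \<bullet> p = 1" "\<And>x. x \<in> C \<Longrightarrow> \<bar>a \<bullet> x\<bar> \<le> 1"
    using opt_contained_harmonic_arithmetic_imp_contact[OF C \<open>0 \<in> interior C\<close> assms(3)] by blast
  \<comment> \<open>Quarter turns of \<open>p\<close> and \<open>a\<close>. Because
    \<open>a \<bullet> p = 1\<close>, the pair \<open>a, c\<close> is the dual basis of
    \<open>p, q\<close>.\<close>
  define c q :: "real ^ 2" where "c = vector [- p $ 2, p $ 1]" and "q = vector [- a $ 2, a $ 1]"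
  have ap: "a $ 1 * p $ 1 + a $ 2 * p $ 2 = 1"
    using p(3) by (simp add: inner_vec_def sum_2)
  have c: "c \<bullet> p = 0" "c \<bullet> q = 1" "a \<bullet> q = 0"
    using ap by (simp_all add: c_def q_def inner_vec_def sum_2 algebra_simps)
  have decomp: "x = (a \<bullet> x) *\<^sub>R p + (c \<bullet> x) *\<^sub>R q" for x
  proof -
    have "x $ 1 = (a $ 1 * p $ 1 + a $ 2 * p $ 2) * x $ 1" "x $ 2 = (a $ 1 * p $ 1 + a $ 2 * p $ 2) * x $ 2"
      using ap by simp_all
    then show ?thesis
      by (simp add: vec_eq_iff forall_2 c_def q_def inner_vec_def sum_2 algebra_simps)
  qed
  have coord: "b \<bullet> x = (b \<bullet> p) * (a \<bullet> x) + (b \<bullet> q) * (c \<bullet> x)" for b x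
    by (subst decomp[of x]) (simp add: inner_add_right mult.commute)
  define P where "P x y \<longleftrightarrow> x *\<^sub>R p + y *\<^sub>R q \<in> C" for x y
  have PC: "P (a \<bullet> x) (c \<bullet> x) \<longleftrightarrow> x \<in> C" for x
    using decomp[of x] by (simp add: P_def)
  have P: "P 1 0" "P (-1) 0" "\<forall>x y. P x y \<longrightarrow> \<bar>x\<bar> \<le> 1"
  proof -
    have "\<bar>x\<bar> \<le> 1" if "P x y" for x y
      using p(4)[OF that[unfolded P_def]] p(3) c(3) by (simp add: inner_add_right)
    with p show "P 1 0" "P (-1) 0" "\<forall>x y. P x y \<longrightarrow> \<bar>x\<bar> \<le> 1"
      by (simp_all add: P_def)
  qed
  define N where "N = {b \<in> polar (dilate (- s) C). \<exists>x\<in>C. b \<bullet> x = 1}"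
  have contacts: "\<exists>x y. contact P r (b \<bullet> p) (b \<bullet> q) x y" if "b \<in> N" for b
  proof -
    obtain x where x: "x \<in> C" "b \<bullet> x = 1"
      using \<open>b \<in> N\<close> by (auto simp: N_def)
    have ge: "- r \<le> b \<bullet> z" if "z \<in> C" for z
    proof -
      have "(- s) *\<^sub>R z \<in> dilate (- s) C"
        using that unfolding dilate_def by (rule imageI)
      then have "b \<bullet> ((- s) *\<^sub>R z) \<le> 1"
        using \<open>b \<in> N\<close> unfolding N_def polar_def by blast
      then have "(- 1) / s \<le> b \<bullet> z"
        unfolding pos_divide_le_eq[OF s(3)] by (simp add: mult.commute)
      then show ?thesis
        by (simp add: r_def)
    qed
    have "- r \<le> b \<bullet> p * x + b \<bullet> q * y" if "P x y" for x y
      using ge[OF that[unfolded P_def]] by (simp add: inner_add_right mult.commute)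
    then have "contact P r (b \<bullet> p) (b \<bullet> q) (a \<bullet> x) (c \<bullet> x)"
      unfolding contact_def PC using x coord[of b x] by auto
    then show ?thesis by blast
  qed
  have "0 \<in> convex hull N"
    using zero_mem_hull_contact_normals[OF C \<open>0 \<in> interior C\<close> assms(2)] s(3)
    by (simp add: N_def s_def)
  then obtain a1 a2 a3 w1 w2 w3 where t: "a1 \<in> N" "a2 \<in> N" "a3 \<in> N" "0 \<le> w1" "0 \<le> w2" "0 \<le> w3"
    "w1 + w2 + w3 = 1" "w1 *\<^sub>R a1 + w2 *\<^sub>R a2 + w3 *\<^sub>R a3 = 0"
    using balanced_triple_if_zero_mem_hull by blast
  have bal: "w1 * (a1 \<bullet> x) + w2 * (a2 \<bullet> x) + w3 * (a3 \<bullet> x) = 0" for x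
    using arg_cong[OF t(8), of "\<lambda>b. b \<bullet> x"] by (simp add: inner_add_left)
  have "s + 1 \<le> s\<^sup>2"
  proof -
    have "?g * (?g - 1) \<le> s * (s - 1)"
      using s golden_ratio_pos by (intro mult_mono) auto
    then show ?thesis
      using golden_ratio_sq s by (simp add: power2_eq_square algebra_simps)
  qed
  then have r: "0 < r" "r\<^sup>2 + r \<le> 1"
    using s by (simp_all add: r_def field_simps power2_eq_square)
  obtain x1 y1 x2 y2 x3 y3 where "contact P r (a1 \<bullet> p) (a1 \<bullet> q) x1 y1"
    "contact P r (a2 \<bullet> p) (a2 \<bullet> q) x2 y2" "contact P r (a3 \<bullet> p) (a3 \<bullet> q) x3 y3"
    using contacts t by meson
  from planar_house_if_balanced_contacts[OF r P this t(4-7) bal bal]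
  have eq: "r\<^sup>2 + r = 1" and "planar_house P r"
    by auto
  have "(s - ?g) * (s + ?g - 1) = 0"
  proof -
    have "s\<^sup>2 = s + 1"
      using eq s by (simp add: r_def field_simps power2_eq_square)
    then show ?thesis
      using golden_ratio_sq by algebra
  qed
  with s golden_ratio_pos have "s = ?g"
    by auto
  then have gr: "?g * r = 1"
    using s by (simp add: r_def)
  from \<open>planar_house P r\<close> obtain \<kappa> where \<kappa>: "\<kappa> \<noteq> 0" "P 0 (1 / \<kappa>)" "P 1 (- r / \<kappa>)" "P (-1) (- r / \<kappa>)"
    and ineq: "\<And>x y. P x y \<Longrightarrow> - r \<le> \<kappa> * y \<and> \<kappa> * y \<le> 1 + x \<and> \<kappa> * y \<le> 1 - x"
    unfolding planar_house_def by blast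
  \<comment> \<open>The factor \<open>?g * \<kappa>\<close> moves the ridge from height
    \<open>1 / \<kappa>\<close> to \<open>?g\<close> and, as \<open>?g * r = 1\<close>, the floor
    from \<open>- r / \<kappa>\<close> to \<open>-1\<close>.\<close>
  define L where "L x = (vector [a \<bullet> x, ?g * \<kappa> * (c \<bullet> x)] :: real ^ 2)" for x
  have L: "linear L"
    by (rule linearI) (simp_all add: L_def vec_eq_iff forall_2 inner_add_right algebra_simps)
  have "x = 0" if "L x = 0" for x
  proof -
    from that have "a \<bullet> x = 0" "c \<bullet> x = 0"
      using \<kappa>(1) golden_ratio_pos by (auto simp: L_def vec_eq_iff forall_2)
    with decomp[of x] show ?thesis by simp
  qed
  then have "inj L"
    using linear_injective_0[OF L] by blast
  then have "bij L"
    using linear_inj_imp_surj[OF L] by (simp add: bij_def)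
  have LP: "vector [x, ?g * \<kappa> * y] \<in> L ` C" if "P x y" for x y
  proof -
    have "L (x *\<^sub>R p + y *\<^sub>R q) = vector [x, ?g * \<kappa> * y]"
      using c p(3) by (simp add: L_def inner_add_right)
    with that show ?thesis
      unfolding P_def by (metis imageI)
  qed
  have "L ` C = golden_house"
  proof (rule golden_house_eq_if_inequalities)
    show "convex (L ` C)"
      using L C by (simp add: convex_linear_image)
    show "vector [1, 0] \<in> L ` C" "vector [-1, 0] \<in> L ` C" "vector [0, ?g] \<in> L ` C"
      "vector [1, -1] \<in> L ` C" "vector [-1, -1] \<in> L ` C"
      using LP[OF P(1)] LP[OF P(2)] \<kappa>(2-4)[THEN LP] \<kappa>(1) gr by simp_all
    fix z assume "z \<in> L ` C"
    then obtain x where x: "x \<in> C" "z = L x" by blast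
    note i = ineq[of "a \<bullet> x" "c \<bullet> x", unfolded PC, OF x(1)]
    have "?g * (- r) \<le> ?g * (\<kappa> * (c \<bullet> x))" "?g * (\<kappa> * (c \<bullet> x)) \<le> ?g * (1 + a \<bullet> x)"
      "?g * (\<kappa> * (c \<bullet> x)) \<le> ?g * (1 - a \<bullet> x)"
      using i golden_ratio_pos by (intro mult_left_mono; simp)+
    moreover have "?g * (- r) = - 1" "z $ 1 = a \<bullet> x" "z $ 2 = ?g * (\<kappa> * (c \<bullet> x))"
      using gr by (simp_all add: x(2) L_def)
    ultimately show "\<bar>z $ 1\<bar> \<le> 1 \<and> -1 \<le> z $ 2 \<and>
        z $ 2 \<le> ?g * (1 + z $ 1) \<and> z $ 2 \<le> ?g * (1 - z $ 1)"
      using p(4)[OF x(1)] by simp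
  qed
  with \<open>s = ?g\<close> L \<open>bij L\<close> show ?thesis
    by (auto simp: s_def)
qed auto

end
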